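(* Let $X,Y$ be 2-3 trees and let $J=X+Y$. Then whether $J$ overflows (i.e. $\mathrm{height}(J)>\mathrm{height}(X)$ and $\mathrm{height}(J)>\mathrm{height}(Y)$), together with $\mathrm{lspine}(J)$ and $\mathrm{rspine}(J)$, can be computed within $O(1)$ steps of integer arithmetic (addition, subtraction, multiplication, modulo, comparison) from the six integers $\mathrm{weight}(X)$, $\mathrm{lspine}(X)$, $\mathrm{rspine}(X)$, $\mathrm{weight}(Y)$, $\mathrm{lspine}(Y)$, $\mathrm{rspine}(Y)$.
   Context: A 2-3 tree is a rooted tree whose leaves are all at the same depth and whose internal nodes each have $2$ or $3$ ordered children. The height of a node $v$ is the height of the subtree at $v$ (leaves have height $0$), and $\mathrm{weight}(v)=2^{\mathrm{height}(v)}$. For a node $v$, $\mathrm{rspine}(v)=\sum_{k=1}^{\mathrm{height}(v)}(c_k-2)\cdot 2^{k-1}$, where $c_k$ is the number of children of the node at height $k$ on the rightmost root-to-leaf path of the subtree at $v$; $\mathrm{lspine}(v)$ is defined symmetrically using the leftmost path. For a tree, these quantities refer to its root. $X+Y$ denotes the standard join of 2-3 trees, yielding a 2-3 tree whose leaves are those of $X$ followed by those of $Y$: if $X,Y$ have equal height, a new root with children $X,Y$ is created; if $X$ is taller, $Y$ is added as the right sibling immediately after the node on the right spine of $X$ having the same height as $Y$, and then, repeatedly going upward, any node with $4$ children is split into two $2$-child nodes (creating a new root if the root splits); symmetrically if $Y$ is taller. *)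

theory Defs
  imports Main
begin

datatype 'a tree23 =
    Leaf 'a
  | Node2 "'a tree23" "'a tree23"
  | Node3 "'a tree23" "'a tree23" "'a tree23"

fun children :: "'a tree23 \<Rightarrow> 'a tree23 list" where
  "children (Leaf x) = []"
| "children (Node2 a b) = [a, b]"
| "children (Node3 a b c) = [a, b, c]"

fun leaves :: "'a tree23 \<Rightarrow> 'a list" where
  "leaves (Leaf x) = [x]"
| "leaves (Node2 a b) = leaves a @ leaves b"
| "leaves (Node3 a b c) = leaves a @ leaves b @ leaves c"

fun leaf_depths :: "'a tree23 \<Rightarrow> nat set" where
  "leaf_depths (Leaf x) = {0}"
| "leaf_depths (Node2 a b) = Suc ` (leaf_depths a \<union> leaf_depths b)"
| "leaf_depths (Node3 a b c) = Suc ` (leaf_depths a \<union> leaf_depths b \<union> leaf_depths c)"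

text \<open>The datatype already forces every internal node to have two or three children.\<close>

definition is_23_tree :: "'a tree23 \<Rightarrow> bool" where
  "is_23_tree t \<longleftrightarrow> (\<forall>d \<in> leaf_depths t. \<forall>e \<in> leaf_depths t. d = e)"

fun height :: "'a tree23 \<Rightarrow> nat" where
  "height (Leaf x) = 0"
| "height (Node2 a b) = Suc (max (height a) (height b))"
| "height (Node3 a b c) = Suc (max (height a) (max (height b) (height c)))"

definition weight :: "'a tree23 \<Rightarrow> int" where
  "weight t = 2 ^ height t"

text \<open>For \<open>k \<le> height t\<close> and a 2-3 tree \<open>t\<close>, \<open>right_node k t\<close> is the node (given as the
  subtree below it) at height \<open>k\<close> on the rightmost root-to-leaf path of \<open>t\<close>.\<close>

fun right_node :: "nat \<Rightarrow> 'a tree23 \<Rightarrow> 'a tree23" where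
  "right_node k (Leaf x) = Leaf x"
| "right_node k (Node2 a b) =
     (if height (Node2 a b) = k then Node2 a b else right_node k b)"
| "right_node k (Node3 a b c) =
     (if height (Node3 a b c) = k then Node3 a b c else right_node k c)"

fun left_node :: "nat \<Rightarrow> 'a tree23 \<Rightarrow> 'a tree23" where
  "left_node k (Leaf x) = Leaf x"
| "left_node k (Node2 a b) =
     (if height (Node2 a b) = k then Node2 a b else left_node k a)"
| "left_node k (Node3 a b c) =
     (if height (Node3 a b c) = k then Node3 a b c else left_node k a)"

definition rspine :: "'a tree23 \<Rightarrow> int" where
  "rspine t = (\<Sum>k = 1..height t. (int (length (children (right_node k t))) - 2) * 2 ^ (k - 1))"

definition lspine :: "'a tree23 \<Rightarrow> int" where
  "lspine t = (\<Sum>k = 1..height t. (int (length (children (left_node k t))) - 2) * 2 ^ (k - 1))"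

text \<open>A node whose child list has grown to four children is not a \<^typ>\<open>'a tree23\<close>; \<open>regroup\<close>
  maps a child list to the list of nodes replacing the original node: the node itself, or the
  two halves of the split node. Only lists of length two, three and four occur.\<close>

fun regroup :: "'a tree23 list \<Rightarrow> 'a tree23 list" where
  "regroup [a, b] = [Node2 a b]"
| "regroup [a, b, c] = [Node3 a b c]"
| "regroup [a, b, c, d] = [Node2 a b, Node2 c d]"
| "regroup ts = ts"

text \<open>\<open>attach_right x y\<close> puts \<open>y\<close> immediately after the node of height \<open>height y\<close> on the right
  spine of \<open>x\<close> and performs the splits inside \<open>x\<close>; the result lists the one or two trees that
  replace \<open>x\<close>. \<open>attach_left x y\<close> puts \<open>x\<close> before the node of height \<open>height x\<close> on the left
  spine of \<open>y\<close>.\<close>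

fun attach_right :: "'a tree23 \<Rightarrow> 'a tree23 \<Rightarrow> 'a tree23 list" where
  "attach_right (Leaf a) y = [Leaf a, y]"
| "attach_right (Node2 a b) y =
     (if height (Node2 a b) = height y then [Node2 a b, y]
      else regroup (a # attach_right b y))"
| "attach_right (Node3 a b c) y =
     (if height (Node3 a b c) = height y then [Node3 a b c, y]
      else regroup (a # b # attach_right c y))"

fun attach_left :: "'a tree23 \<Rightarrow> 'a tree23 \<Rightarrow> 'a tree23 list" where
  "attach_left x (Leaf a) = [x, Leaf a]"
| "attach_left x (Node2 a b) =
     (if height (Node2 a b) = height x then [x, Node2 a b]
      else regroup (attach_left x a @ [b]))"
| "attach_left x (Node3 a b c) =
     (if height (Node3 a b c) = height x then [x, Node3 a b c]
      else regroup (attach_left x a @ [b, c]))"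

fun make_root :: "'a tree23 list \<Rightarrow> 'a tree23" where
  "make_root [s, t] = Node2 s t"
| "make_root ts = hd ts"

definition join :: "'a tree23 \<Rightarrow> 'a tree23 \<Rightarrow> 'a tree23" where
  "join x y =
     (if height x = height y then Node2 x y
      else if height x > height y then make_root (attach_right x y)
      else make_root (attach_left x y))"

definition overflows :: "'a tree23 \<Rightarrow> 'a tree23 \<Rightarrow> bool" where
  "overflows x y \<longleftrightarrow> height (join x y) > height x \<and> height (join x y) > height y"

lemma is_23_tree_children:
  "is_23_tree (Node2 a b) \<Longrightarrow> is_23_tree a \<and> is_23_tree b"
  "is_23_tree (Node3 a b c) \<Longrightarrow> is_23_tree a \<and> is_23_tree b \<and> is_23_tree c"
  unfolding is_23_tree_def leaf_depths.simps by blast+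

lemma is_23_tree_height: "is_23_tree t \<Longrightarrow> leaf_depths t = {height t}"
proof (induction t)
  case (Node2 a b)
  from Node2.IH is_23_tree_children(1)[OF Node2.prems]
  have "leaf_depths a = {height a}" "leaf_depths b = {height b}" by blast+
  moreover from this Node2.prems have "height a = height b"
    unfolding is_23_tree_def leaf_depths.simps by blast
  ultimately show ?case by simp
next
  case (Node3 a b c)
  from Node3.IH is_23_tree_children(2)[OF Node3.prems]
  have "leaf_depths a = {height a}" "leaf_depths b = {height b}" "leaf_depths c = {height c}"
    by blast+
  moreover from this Node3.prems have "height a = height b" "height b = height c"
    unfolding is_23_tree_def leaf_depths.simps by blast+
  ultimately show ?case by simp
qed simp

lemma is_23_tree_simps:
  "is_23_tree (Leaf x)"
  "is_23_tree (Node2 a b) \<longleftrightarrow> is_23_tree a \<and> is_23_tree b \<and> height a = height b"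
  "is_23_tree (Node3 a b c) \<longleftrightarrow>
     is_23_tree a \<and> is_23_tree b \<and> is_23_tree c \<and> height a = height b \<and> height b = height c"
proof -
  show "is_23_tree (Leaf x)" by (simp add: is_23_tree_def)
  have "is_23_tree (Node2 a b) \<longleftrightarrow> height a = height b" if "is_23_tree a" "is_23_tree b"
    using that[THEN is_23_tree_height] unfolding is_23_tree_def leaf_depths.simps by auto
  then show "is_23_tree (Node2 a b) \<longleftrightarrow> is_23_tree a \<and> is_23_tree b \<and> height a = height b"
    using is_23_tree_children(1) by blast
  have "is_23_tree (Node3 a b c) \<longleftrightarrow> height a = height b \<and> height b = height c"
    if "is_23_tree a" "is_23_tree b" "is_23_tree c"
    using that[THEN is_23_tree_height] unfolding is_23_tree_def leaf_depths.simps by auto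
  then show "is_23_tree (Node3 a b c) \<longleftrightarrow>
     is_23_tree a \<and> is_23_tree b \<and> is_23_tree c \<and> height a = height b \<and> height b = height c"
    using is_23_tree_children(2) by blast
qed

lemma attach_right_correct:
  assumes "is_23_tree x" "is_23_tree y" "height y \<le> height x"
  shows "(\<exists>s. attach_right x y = [s] \<and> is_23_tree s \<and> height s = height x \<and>
            leaves s = leaves x @ leaves y) \<or>
         (\<exists>s t. attach_right x y = [s, t] \<and> is_23_tree s \<and> is_23_tree t \<and>
            height s = height x \<and> height t = height x \<and>
            leaves s @ leaves t = leaves x @ leaves y)"
  using assms
proof (induction x)
  case (Node2 a b)
  then have inv: "is_23_tree a" "is_23_tree b" "height b = height a"
    by (simp_all add: is_23_tree_simps)
  show ?case
  proof (cases "height y = Suc (height a)")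
    case True
    with Node2.prems inv show ?thesis by simp
  next
    case False
    with Node2.prems inv have "height y \<le> height b" by simp
    from Node2.IH(2)[OF _ Node2.prems(2) this] inv
    show ?thesis using False by (auto simp: is_23_tree_simps)
  qed
next
  case (Node3 a b c)
  then have inv: "is_23_tree a" "is_23_tree b" "is_23_tree c" "height b = height a" "height c = height a"
    by (simp_all add: is_23_tree_simps)
  show ?case
  proof (cases "height y = Suc (height a)")
    case True
    with Node3.prems inv show ?thesis by simp
  next
    case False
    with Node3.prems inv have "height y \<le> height c" by simp
    from Node3.IH(3)[OF _ Node3.prems(2) this] inv
    show ?thesis using False by (auto simp: is_23_tree_simps)
  qed
qed (simp add: is_23_tree_simps)

lemma attach_left_correct:
  assumes "is_23_tree x" "is_23_tree y" "height x \<le> height y"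
  shows "(\<exists>s. attach_left x y = [s] \<and> is_23_tree s \<and> height s = height y \<and>
            leaves s = leaves x @ leaves y) \<or>
         (\<exists>s t. attach_left x y = [s, t] \<and> is_23_tree s \<and> is_23_tree t \<and>
            height s = height y \<and> height t = height y \<and>
            leaves s @ leaves t = leaves x @ leaves y)"
  using assms
proof (induction y)
  case (Node2 a b)
  then have inv: "is_23_tree a" "is_23_tree b" "height b = height a"
    by (simp_all add: is_23_tree_simps)
  show ?case
  proof (cases "height x = Suc (height a)")
    case True
    with Node2.prems inv show ?thesis by simp
  next
    case False
    with Node2.prems inv have "height x \<le> height a" by simp
    from Node2.IH(1)[OF Node2.prems(1) _ this] inv
    show ?thesis using False by (auto simp: is_23_tree_simps)
  qed
next
  case (Node3 a b c)
  then have inv: "is_23_tree a" "is_23_tree b" "is_23_tree c" "height b = height a" "height c = height a"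
    by (simp_all add: is_23_tree_simps)
  show ?case
  proof (cases "height x = Suc (height a)")
    case True
    with Node3.prems inv show ?thesis by simp
  next
    case False
    with Node3.prems inv have "height x \<le> height a" by simp
    from Node3.IH(1)[OF Node3.prems(1) _ this] inv
    show ?thesis using False by (auto simp: is_23_tree_simps)
  qed
qed (simp add: is_23_tree_simps)

lemma join_correct:
  assumes "is_23_tree x" "is_23_tree y"
  shows "is_23_tree (join x y)" "leaves (join x y) = leaves x @ leaves y"
  using attach_right_correct[OF assms] attach_left_correct[OF assms] assms
  by (auto simp: join_def is_23_tree_simps)

text \<open>Integer register machines. Every instruction counts as one step. \<open>Mod\<close> by a
  nonpositive modulus is an error, so no convention for such moduli enters; for a positive
  modulus \<open>m\<close> the result lies in \<open>{0..<m}\<close>.\<close>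

datatype instr =
    Const nat int
  | Add nat nat nat
  | Sub nat nat nat
  | Mul nat nat nat
  | Mod nat nat nat
  | JumpLess nat nat nat
  | JumpEq nat nat nat

type_synonym program = "instr list"
type_synonym config = "nat \<times> (nat \<Rightarrow> int)"

fun exec_instr :: "instr \<Rightarrow> config \<Rightarrow> config option" where
  "exec_instr (Const d c) (pc, r) = Some (Suc pc, r(d := c))"
| "exec_instr (Add d a b) (pc, r) = Some (Suc pc, r(d := r a + r b))"
| "exec_instr (Sub d a b) (pc, r) = Some (Suc pc, r(d := r a - r b))"
| "exec_instr (Mul d a b) (pc, r) = Some (Suc pc, r(d := r a * r b))"
| "exec_instr (Mod d a b) (pc, r) =
     (if r b > 0 then Some (Suc pc, r(d := r a mod r b)) else None)"
| "exec_instr (JumpLess a b l) (pc, r) = Some (if r a < r b then l else Suc pc, r)"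
| "exec_instr (JumpEq a b l) (pc, r) = Some (if r a = r b then l else Suc pc, r)"

text \<open>A program halts when the program counter leaves it. \<open>run p n (pc, r)\<close> is the final register
  content if \<open>p\<close> halts without error after at most \<open>n\<close> steps, and \<open>None\<close> otherwise.\<close>

fun run :: "program \<Rightarrow> nat \<Rightarrow> config \<Rightarrow> (nat \<Rightarrow> int) option" where
  "run p 0 (pc, r) = (if pc < length p then None else Some r)"
| "run p (Suc n) (pc, r) =
     (if pc < length p then Option.bind (exec_instr (p ! pc) (pc, r)) (run p n) else Some r)"

definition computes_within :: "program \<Rightarrow> nat \<Rightarrow> int list \<Rightarrow> int list \<Rightarrow> bool" where
  "computes_within p n inputs outputs \<longleftrightarrow>
     (\<exists>r. run p n (0, \<lambda>i. if i < length inputs then inputs ! i else 0) = Some r \<and>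
          (\<forall>i < length outputs. r i = outputs ! i))"

end

(*
  Read the spines as binary numbers: the digit of rspine v at position k - 1 records whether the
  node at height k has three children.  If X is taller than Y, inserting Y adds one child at height
  height Y + 1 of the right spine of X, and splitting 4-child nodes is carry propagation.  Hence the
  right spine of the join is the binary sum
    V = (rspine X with the digits below weight Y replaced by those of rspine Y) + weight Y,
  and the join overflows iff V >= weight X, in which case the carry out is dropped.  The left spine
  changes only at the root of X, i.e. by at most one digit of value h = weight X / 2.  There is no
  division instruction, but h = weight X ^ 2 mod (2 * weight X - 1), because
  2 * weight X is congruent to 1.  The case of a taller Y is the mirror image.
*)

theory Submission
  imports Defs
begin

section \<open>Spines as binary numbers\<close>

lemma rspine_simps:
  "rspine (Leaf x) = 0"
  "is_23_tree (Node2 a b) \<Longrightarrow> rspine (Node2 a b) = rspine b"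
  "is_23_tree (Node3 a b c) \<Longrightarrow> rspine (Node3 a b c) = 2 ^ height c + rspine c"
  unfolding rspine_def by (auto simp: is_23_tree_simps intro!: sum.cong)

lemma lspine_simps:
  "lspine (Leaf x) = 0"
  "is_23_tree (Node2 a b) \<Longrightarrow> lspine (Node2 a b) = lspine a"
  "is_23_tree (Node3 a b c) \<Longrightarrow> lspine (Node3 a b c) = 2 ^ height a + lspine a"
  unfolding lspine_def by (auto simp: is_23_tree_simps intro!: sum.cong)

lemma rspine_bounds:
  assumes "is_23_tree t"
  shows "0 \<le> rspine t" "rspine t < 2 ^ height t"
  using assms by (induction t) (auto simp: rspine_simps is_23_tree_simps)

section \<open>The right spine under attachment\<close>

definition attached_rspine :: "'a tree23 \<Rightarrow> 'a tree23 \<Rightarrow> int" where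
  "attached_rspine x y = rspine x - rspine x mod weight y + weight y + rspine y"

text \<open>\<open>weight y\<close> divides the root's contribution \<open>2 ^ height c\<close>, so
  replacing the low digits commutes with stripping the root.\<close>

lemma attached_rspine_simps:
  "is_23_tree (Node2 a b) \<Longrightarrow> attached_rspine (Node2 a b) y = attached_rspine b y"
  "is_23_tree (Node3 a b c) \<Longrightarrow> height y \<le> height c \<Longrightarrow>
     attached_rspine (Node3 a b c) y = 2 ^ height c + attached_rspine c y"
proof -
  show "is_23_tree (Node2 a b) \<Longrightarrow> attached_rspine (Node2 a b) y = attached_rspine b y"
    by (simp add: attached_rspine_def rspine_simps)
  assume "is_23_tree (Node3 a b c)" "height y \<le> height c"
  moreover have "(2 ^ height c + rspine c) mod 2 ^ height y = rspine c mod 2 ^ height y"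
    using \<open>height y \<le> height c\<close> by (simp add: le_imp_power_dvd mod_add_eq flip: mod_add_left_eq)
  ultimately show "attached_rspine (Node3 a b c) y = 2 ^ height c + attached_rspine c y"
    by (simp add: attached_rspine_def rspine_simps weight_def)
qed

lemma attached_rspine_same_height:
  assumes "is_23_tree x" "height x = height y"
  shows "attached_rspine x y = weight y + rspine y"
  using rspine_bounds[OF assms(1)] assms(2) by (simp add: attached_rspine_def weight_def)

text \<open>A split last child turns a \<open>Node2\<close> into a \<open>Node3\<close>, which
  absorbs the carry as a digit 1; a \<open>Node3\<close> splits in turn, its right half has digit 0
  and the carry moves up. Since \<open>rspine t\<close> is nonnegative, two trees mean that the sum
  has reached \<open>2 ^ height x\<close>.\<close>

lemma rspine_attach_right:
  assumes "is_23_tree x" "is_23_tree y" "height y \<le> height x"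
  shows "(\<exists>s. attach_right x y = [s] \<and> is_23_tree s \<and> height s = height x \<and>
            rspine s = attached_rspine x y \<and> attached_rspine x y < 2 ^ height x) \<or>
         (\<exists>s t. attach_right x y = [s, t] \<and> is_23_tree s \<and> is_23_tree t \<and>
            height s = height x \<and> height t = height x \<and>
            rspine t = attached_rspine x y - 2 ^ height x)"
  using assms
proof (induction x)
  case (Leaf a)
  then show ?case
    using attached_rspine_same_height[of "Leaf a" y] by (auto simp: is_23_tree_simps weight_def)
next
  case (Node2 a b)
  then have inv: "is_23_tree a" "is_23_tree b" "height b = height a"
    by (simp_all add: is_23_tree_simps)
  show ?case
  proof (cases "height y = Suc (height a)")
    case True
    with Node2.prems inv show ?thesis
      using attached_rspine_same_height[of "Node2 a b" y] by (simp add: weight_def)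
  next
    case False
    with Node2.prems inv have le: "height y \<le> height b" by simp
    have V: "attached_rspine (Node2 a b) y = attached_rspine b y"
      using Node2.prems by (simp add: attached_rspine_simps)
    from Node2.IH(2)[OF inv(2) Node2.prems(2) le] show ?thesis
    proof (elim disjE exE conjE)
      fix s
      assume s: "attach_right b y = [s]" "is_23_tree s" "height s = height b"
        "rspine s = attached_rspine b y" "attached_rspine b y < 2 ^ height b"
      from s(5) have "attached_rspine b y < 2 * 2 ^ height b"
        using zero_less_power[of "2::int" "height b"] by linarith
      with s inv False V show ?thesis by (simp add: is_23_tree_simps rspine_simps)
    next
      fix s t
      assume s: "attach_right b y = [s, t]" "is_23_tree s" "is_23_tree t"
        "height s = height b" "height t = height b" "rspine t = attached_rspine b y - 2 ^ height b"
      \<comment> \<open>\<open>rspine t\<close> is below \<open>2 ^ height t\<close>, so the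
        absorbed carry stays below the next power of two.\<close>
      with s inv False V rspine_bounds[OF s(3)] show ?thesis
        by (simp add: is_23_tree_simps rspine_simps)
    qed
  qed
next
  case (Node3 a b c)
  then have inv: "is_23_tree a" "is_23_tree b" "is_23_tree c" "height b = height a" "height c = height a"
    by (simp_all add: is_23_tree_simps)
  show ?case
  proof (cases "height y = Suc (height a)")
    case True
    with Node3.prems inv show ?thesis
      using attached_rspine_same_height[of "Node3 a b c" y] by (simp add: weight_def)
  next
    case False
    with Node3.prems inv have le: "height y \<le> height c" by simp
    have V: "attached_rspine (Node3 a b c) y = 2 ^ height c + attached_rspine c y"
      using Node3.prems le by (simp add: attached_rspine_simps)
    from Node3.IH(3)[OF inv(3) Node3.prems(2) le] show ?thesis
      using inv False V by (auto simp: is_23_tree_simps rspine_simps)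
  qed
qed

section \<open>Data of the join for a taller first tree\<close>

text \<open>The arguments are the weight, left and right spine of the taller tree and the weight and
  right spine of the lower one.\<close>

definition join_data :: "int \<Rightarrow> int \<Rightarrow> int \<Rightarrow> int \<Rightarrow> int \<Rightarrow> bool \<times> int \<times> int" where
  "join_data w l r w' r' =
     (let v = r - r mod w' + w' + r'; h = w * w mod (w + w - 1) in
      if v < w then (False, (if r < h \<and> h \<le> v then l + h else l), v)
      else (True, l - h, v - w))"

lemma half_power2_eq_mod: "(2::int) ^ Suc n * 2 ^ Suc n mod (2 ^ Suc n + 2 ^ Suc n - 1) = 2 ^ n"
proof -
  \<comment> \<open>With h = 2 ^ n the modulus is 4h - 1, and 4h * h = h + (4h - 1) * h.\<close>
  have "(2::int) ^ Suc n * 2 ^ Suc n = 2 ^ n + (2 ^ Suc n + 2 ^ Suc n - 1) * 2 ^ n"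
    by (simp add: algebra_simps)
  moreover have "(2::int) ^ n < 2 ^ Suc n + 2 ^ Suc n - 1" "(0::int) \<le> 2 ^ n"
    using zero_less_power[of "2::int" n] by (simp_all del: zero_less_power)
  ultimately show ?thesis by (simp only: mod_mult_self2 mod_pos_pos_trivial)
qed

text \<open>The test \<open>r < h\<close> detects a \<open>Node2\<close> root, and for such a root
  \<open>h \<le> v\<close> says that the carry arrives there and makes it a \<open>Node3\<close>.
  Overflow requires a \<open>Node3\<close> root, whose left half then loses the digit h.\<close>

lemma join_taller:
  assumes "is_23_tree x" "is_23_tree y" "height y < height x"
  shows "(overflows x y, lspine (join x y), rspine (join x y)) =
    join_data (weight x) (lspine x) (rspine x) (weight y) (rspine y)"
proof (cases x)
  case (Leaf a)
  with assms show ?thesis by simp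
next
  case (Node2 a b)
  with assms have inv: "is_23_tree a" "is_23_tree b" "height b = height a" "height y \<le> height b"
    by (simp_all add: is_23_tree_simps)
  have h: "weight x * weight x mod (weight x + weight x - 1) = 2 ^ height b"
    using half_power2_eq_mod[of "height b"] by (simp add: Node2 weight_def inv)
  have V: "rspine x - rspine x mod weight y + weight y + rspine y = attached_rspine b y"
    using assms(1) by (simp add: Node2 attached_rspine_simps flip: attached_rspine_def)
  note join = join_def overflows_def join_data_def Let_def h V
  \<comment> \<open>Applied to the last child, not to \<open>x\<close>: whether that child splits
    decides the new arity of the root, which the left spine records.\<close>
  from rspine_attach_right[OF inv(2) assms(2) inv(4)] show ?thesis
  proof (elim disjE exE conjE)
    fix s
    assume s: "attach_right b y = [s]" "is_23_tree s" "height s = height b"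
      "rspine s = attached_rspine b y" "attached_rspine b y < 2 ^ height b"
    have "(2::int) ^ height b > 0" by simp
    with s inv assms rspine_bounds[OF inv(2)] show ?thesis
      unfolding join by (auto simp: Node2 is_23_tree_simps rspine_simps lspine_simps weight_def)
  next
    fix s t
    assume s: "attach_right b y = [s, t]" "is_23_tree s" "is_23_tree t"
      "height s = height b" "height t = height b" "rspine t = attached_rspine b y - 2 ^ height b"
    with s inv assms rspine_bounds[OF s(3)] rspine_bounds[OF inv(2)] show ?thesis
      unfolding join by (auto simp: Node2 is_23_tree_simps rspine_simps lspine_simps weight_def)
  qed
next
  case (Node3 a b c)
  with assms have inv: "is_23_tree a" "is_23_tree b" "is_23_tree c"
      "height b = height a" "height c = height a" "height y \<le> height c"
    by (simp_all add: is_23_tree_simps)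
  have h: "weight x * weight x mod (weight x + weight x - 1) = 2 ^ height c"
    using half_power2_eq_mod[of "height c"] by (simp add: Node3 weight_def inv)
  have V: "rspine x - rspine x mod weight y + weight y + rspine y = 2 ^ height c + attached_rspine c y"
    using assms(1) inv by (simp add: Node3 attached_rspine_simps flip: attached_rspine_def)
  note join = join_def overflows_def join_data_def Let_def h V
  from rspine_attach_right[OF inv(3) assms(2) inv(6)] show ?thesis
  proof (elim disjE exE conjE)
    fix s
    assume s: "attach_right c y = [s]" "is_23_tree s" "height s = height c"
      "rspine s = attached_rspine c y" "attached_rspine c y < 2 ^ height c"
    with inv assms rspine_bounds[OF inv(3)] show ?thesis
      unfolding join by (auto simp: Node3 is_23_tree_simps rspine_simps lspine_simps weight_def)
  next
    fix s t
    assume s: "attach_right c y = [s, t]" "is_23_tree s" "is_23_tree t"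
      "height s = height c" "height t = height c" "rspine t = attached_rspine c y - 2 ^ height c"
    with inv assms rspine_bounds[OF s(3)] rspine_bounds[OF inv(3)] show ?thesis
      unfolding join by (auto simp: Node3 is_23_tree_simps rspine_simps lspine_simps weight_def)
  qed
qed

section \<open>Mirror images, for a taller second tree\<close>

fun mirror :: "'a tree23 \<Rightarrow> 'a tree23" where
  "mirror (Leaf x) = Leaf x"
| "mirror (Node2 a b) = Node2 (mirror b) (mirror a)"
| "mirror (Node3 a b c) = Node3 (mirror c) (mirror b) (mirror a)"

lemma mirror_mirror [simp]: "mirror (mirror t) = t"
  by (induction t) auto

lemma height_mirror [simp]: "height (mirror t) = height t"
  by (induction t) auto

lemma weight_mirror [simp]: "weight (mirror t) = weight t"
  by (simp add: weight_def)

lemma is_23_tree_mirror [simp]: "is_23_tree (mirror t) = is_23_tree t"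
  by (induction t) (auto simp: is_23_tree_simps)

lemma length_children_mirror [simp]: "length (children (mirror t)) = length (children t)"
  by (cases t) auto

lemma left_node_mirror: "left_node k (mirror t) = mirror (right_node k t)"
  by (induction t) (auto simp: max.commute max.left_commute)

lemma lspine_mirror [simp]: "lspine (mirror t) = rspine t"
  by (simp add: lspine_def rspine_def left_node_mirror)

lemma rspine_mirror [simp]: "rspine (mirror t) = lspine t"
  using lspine_mirror[of "mirror t"] by simp

text \<open>Four children are split in the middle, which is symmetric; lists of length other than 2,
  3, 4 are left unchanged.\<close>

lemma regroup_mirror: "regroup (rev (map mirror ts)) = rev (map mirror (regroup ts))"
proof (cases "length ts \<in> {2, 3, 4}")
  case True
  then show ?thesis
    by (auto simp: numeral_eq_Suc length_Suc_conv)
next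
  case False
  have id: "regroup us = us" if "length us \<notin> {2, 3, 4}" for us :: "'a tree23 list"
    using that by (induction us rule: regroup.induct) auto
  show ?thesis using False id[of ts] id[of "rev (map mirror ts)"] by simp
qed

lemma attach_left_mirror:
  "attach_left (mirror y) (mirror x) = rev (map mirror (attach_right x y))"
proof (induction x)
  case (Node2 a b)
  then show ?case
    using regroup_mirror[of "a # attach_right b y"] by (simp add: max.commute)
next
  case (Node3 a b c)
  then show ?case
    using regroup_mirror[of "a # b # attach_right c y"]
    by (simp add: max.commute max.left_commute)
qed simp

lemma join_mirror:
  assumes "is_23_tree x" "is_23_tree y" "height y < height x"
  shows "join (mirror y) (mirror x) = mirror (join x y)"
  using attach_right_correct[of x y] assms
  by (auto simp: join_def attach_left_mirror)

lemma join_lower: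
  assumes "is_23_tree x" "is_23_tree y" "height x < height y"
  shows "(overflows x y, rspine (join x y), lspine (join x y)) =
    join_data (weight y) (rspine y) (lspine y) (weight x) (lspine x)"
proof -
  have "join x y = mirror (join (mirror y) (mirror x))"
    using join_mirror[of "mirror y" "mirror x"] assms by simp
  then show ?thesis
    using join_taller[of "mirror y" "mirror x"] assms by (simp add: overflows_def conj_commute)
qed

section \<open>The register program\<close>

text \<open>A fragment for \<^const>\<open>join_data\<close>, to be placed at address \<open>n\<close> and left by a jump to \<open>e\<close>; the other
  arguments are registers. Register 8 holds \<open>v\<close>, register 9 holds \<open>h\<close>, and register 6 must
  contain 0. The destinations may coincide with inputs, so their writes come last.\<close>

definition join_code ::
  "nat \<Rightarrow> nat \<Rightarrow> nat \<Rightarrow> nat \<Rightarrow> nat \<Rightarrow> nat \<Rightarrow> nat \<Rightarrow> nat \<Rightarrow> nat \<Rightarrow> program" where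
  "join_code n e w l r w' r' dl dr =
    [Mod 7 r w', Sub 8 r 7, Add 8 8 w', Add 8 8 r',
     Mul 9 w w, Add 10 w w, Const 11 1, Sub 10 10 11, Mod 9 9 10,
     JumpLess 8 w (n + 14),
     Sub dl l 9, Sub dr 8 w, Const 0 1, JumpEq 6 6 e,
     JumpLess 8 9 (n + 16), JumpLess r 9 (n + 17), Const 9 0,
     Add dl l 9, Add dr 8 6, Const 0 0, JumpEq 6 6 e]"

text \<open>Each fragment has 21 instructions: taller X at 2, taller Y at 23 with the spines
  exchanged, equal heights at 44, halt at 46.\<close>

definition join_program :: program where
  "join_program = [JumpEq 0 3 44, JumpLess 0 3 23]
     @ join_code 2 46 0 1 2 3 5 1 2
     @ join_code 23 46 3 5 4 0 1 2 1
     @ [Const 0 1, Add 2 5 6]"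

lemma join_program_equal:
  "computes_within join_program 30 [w, l, r, w, l', r'] [1, l, r']"
  by (simp add: computes_within_def join_program_def join_code_def eval_nat_numeral All_less_Suc)

text \<open>The hypotheses make both moduli, w' and w + w - 1, positive, so \<open>Mod\<close> never
  fails. The longest path takes 19 steps.\<close>

lemma join_program_taller:
  assumes "w' < w" "0 < w'"
  shows "computes_within join_program 30 [w, l, r, w', l', r']
    (case join_data w l r w' r' of (ov, l, r) \<Rightarrow> [of_bool ov, l, r])"
  using assms
  by (simp add: computes_within_def join_program_def join_code_def eval_nat_numeral All_less_Suc
      join_data_def Let_def)

lemma join_program_lower:
  assumes "w < w'" "0 < w"
  shows "computes_within join_program 30 [w, l, r, w', l', r']
    (case join_data w' r' l' w l of (ov, r, l) \<Rightarrow> [of_bool ov, l, r])"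
  using assms
  by (simp add: computes_within_def join_program_def join_code_def eval_nat_numeral All_less_Suc
      join_data_def Let_def)

theorem mainTheorem12:
  "\<exists>(p :: program) (c :: nat). \<forall>X Y :: 'a tree23. is_23_tree X \<longrightarrow> is_23_tree Y \<longrightarrow>
     computes_within p c
       [weight X, lspine X, rspine X, weight Y, lspine Y, rspine Y]
       [of_bool (overflows X Y), lspine (join X Y), rspine (join X Y)]"
proof (intro exI allI impI)
  fix X Y :: "'a tree23"
  assume XY: "is_23_tree X" "is_23_tree Y"
  have pos: "weight X > 0" "weight Y > 0" by (simp_all add: weight_def)
  consider "height X = height Y" | "height Y < height X" | "height X < height Y" by linarith
  then show "computes_within join_program 30
      [weight X, lspine X, rspine X, weight Y, lspine Y, rspine Y]
      [of_bool (overflows X Y), lspine (join X Y), rspine (join X Y)]"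
  proof cases
    case 1
    with XY have "join X Y = Node2 X Y" "is_23_tree (Node2 X Y)" "overflows X Y"
      by (simp_all add: join_def overflows_def is_23_tree_simps)
    then show ?thesis
      using join_program_equal[of "weight X"] 1 by (simp add: weight_def lspine_simps rspine_simps)
  next
    case 2
    then have "weight Y < weight X" by (simp add: weight_def)
    from join_program_taller[OF this pos(2), of "lspine X" "rspine X" "lspine Y" "rspine Y"] show ?thesis
      by (simp only: join_taller[OF XY 2, symmetric] prod.case)
  next
    case 3
    then have "weight X < weight Y" by (simp add: weight_def)
    from join_program_lower[OF this pos(1), of "lspine X" "rspine X" "lspine Y" "rspine Y"] show ?thesis
      by (simp only: join_lower[OF XY 3, symmetric] prod.case)
  qed
qed

end
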